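(* For every positive integer $N$, \begin{equation*} F_N(a,b;t) = \frac{1-tq^{N+1}}{1-t}+ \frac{(1-q^{N+1})(b-a)tq}{(1-bq)(1-t)}F_N(a,bq;tq). \end{equation*}
   Context: Let $|q|<1$ and use the $q$-Pochhammer notation $(A)_0=(A;q)_0=1$, $(A)_n=(A;q)_n=(1-A)(1-Aq)\cdots(1-Aq^{n-1})$ for $n\ge 1$, and the Gaussian binomial coefficient $\begin{bmatrix} N\\ n\end{bmatrix}=\frac{(q)_N}{(q)_n(q)_{N-n}}$. For $N\in\mathbb{N}$ the finite analogue of Fine's function is defined by \begin{equation*} F_{N}(a,b;t):=\sum_{n=0}^{N}\begin{bmatrix} N\\ n\end{bmatrix}\frac{(a q)_{n}(t)_{N-n}(q)_n t^{n}}{(b q)_{n}(t)_N }. \end{equation*} Parameters $a,b,t$ are such that all denominators are nonzero.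
   Formalization: The left side is F_{N+1}(a,b;t) instead of F_N(a,b;t), with denominators of F_{N+1} assumed nonzero; as printed the identity fails, e.g. N=1, q=1/2, a=0, b=1, t=-1 gives 1/2 on the left and 1/3 on the right. *)

theory Defs
  imports Complex_Main
begin

definition qpoch :: "complex \<Rightarrow> complex \<Rightarrow> nat \<Rightarrow> complex" where
  "qpoch A q n = (\<Prod>k<n. 1 - A * q ^ k)"

(* Only meaningful for n <= N, because of the truncated subtraction N - n. *)
definition gauss_binom :: "complex \<Rightarrow> nat \<Rightarrow> nat \<Rightarrow> complex" where
  "gauss_binom q N n = qpoch q q N / (qpoch q q n * qpoch q q (N - n))"

definition Fine_F :: "complex \<Rightarrow> nat \<Rightarrow> complex \<Rightarrow> complex \<Rightarrow> complex \<Rightarrow> complex" where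
  "Fine_F q N a b t =
     (\<Sum>n=0..N. gauss_binom q N n *
        (qpoch (a * q) q n * qpoch t q (N - n) * qpoch q q n * t ^ n) /
        (qpoch (b * q) q n * qpoch t q N))"

end

(* The identity is a summation by parts.  With M = N + 1, r n = (aq)_n / (bq)_n and
   e n = t^n (tq)_{M-n} / (q)_{M-n}, the n-th term of F_M(a,b;t) is (q)_M / (t)_M times
   r n (e n - e (n+1)) for n < M, and times r M e M for n = M.  Moving the difference from e to r
   leaves the boundary term r 0 e 0, which gives (1 - t q^M) / (1 - t), and the sum of
   e (n+1) (r (n+1) - r n); since (b - a) q^(n+1) = (1 - a q^(n+1)) - (1 - b q^(n+1)), this is
   the remaining multiple of F_N(a,bq;tq). *)
theory Submission
  imports Defs
begin

lemma qpoch_0 [simp]: "qpoch A q 0 = 1"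
  by (simp add: qpoch_def)

lemma qpoch_Suc: "qpoch A q (Suc n) = qpoch A q n * (1 - A * q ^ n)"
  by (simp add: qpoch_def)

lemma qpoch_Suc_shift: "qpoch A q (Suc n) = (1 - A) * qpoch (A * q) q n"
  unfolding qpoch_def by (subst prod.lessThan_Suc_shift) (simp add: mult.assoc)

text \<open>Each factor is \<open>1 - q ^ (k + 1)\<close>, and \<open>norm q < 1\<close> keeps that
  power off the unit circle.\<close>

lemma qpoch_self_neq_0:
  assumes "norm q < 1"
  shows "qpoch q q n \<noteq> 0"
proof -
  have "q * q ^ k \<noteq> 1" for k
  proof
    assume "q * q ^ k = 1"
    then have "norm q ^ Suc k = 1"
      by (metis norm_one norm_power power_Suc)
    moreover have "norm q ^ Suc k < 1"
      using assms by (simp add: power_less_one_iff del: power_Suc)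
    ultimately show False by simp
  qed
  then show ?thesis by (auto simp: qpoch_def)
qed

lemma summation_by_parts:
  fixes r e :: "nat \<Rightarrow> 'a::comm_ring"
  shows "(\<Sum>n\<le>N. r n * (e n - e (Suc n))) + r (Suc N) * e (Suc N)
         = r 0 * e 0 + (\<Sum>n\<le>N. e (Suc n) * (r (Suc n) - r n))"
  by (induction N) (simp_all add: algebra_simps)

text \<open>The factor \<open>(q)_n\<close> cancels against the Gaussian binomial, so
  \<open>n\<close> and \<open>N - n\<close> separate in each term.\<close>

lemma Fine_F_eq:
  assumes "norm q < 1"
  shows "Fine_F q N a b t = qpoch q q N / qpoch t q N *
    (\<Sum>n\<le>N. qpoch (a * q) q n / qpoch (b * q) q n * t ^ n *
             (qpoch t q (N - n) / qpoch q q (N - n)))"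
  unfolding Fine_F_def gauss_binom_def sum_distrib_left atMost_atLeast0
  using qpoch_self_neq_0[OF assms] by (intro sum.cong) (auto simp: field_simps)

text \<open>Over a common denominator this is
  \<open>(1 - t q^(m+1)) - t (1 - q^(m+1)) = 1 - t\<close>. Taking \<open>m = N - n\<close> and
  multiplying by \<open>t ^ n\<close> gives \<open>e n - e (Suc n)\<close>.\<close>

lemma qpoch_quotient_difference:
  assumes "norm q < 1"
  shows "qpoch t q (Suc m) / qpoch q q (Suc m)
       = qpoch (t * q) q (Suc m) / qpoch q q (Suc m) - t * (qpoch (t * q) q m / qpoch q q m)"
proof -
  define Q T where "Q = qpoch q q m" and "T = qpoch (t * q) q m"
  have "qpoch q q (Suc m) \<noteq> 0"
    by (rule qpoch_self_neq_0[OF assms])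
  then have "Q \<noteq> 0" "1 - q * q ^ m \<noteq> 0"
    by (auto simp: qpoch_Suc Q_def)
  then have "(1 - t) * T / (Q * (1 - q * q ^ m))
       = T * (1 - t * q * q ^ m) / (Q * (1 - q * q ^ m)) - t * (T / Q)"
    by (simp add: divide_simps) (simp add: algebra_simps)
  moreover have "qpoch t q (Suc m) = (1 - t) * T"
    by (simp add: qpoch_Suc_shift T_def)
  ultimately show ?thesis
    by (simp add: qpoch_Suc Q_def T_def)
qed

lemma qpoch_ratio_difference:
  assumes "qpoch (b * q) q (Suc n) \<noteq> 0"
  shows "qpoch (a * q) q (Suc n) / qpoch (b * q) q (Suc n) - qpoch (a * q) q n / qpoch (b * q) q n
       = (b - a) * q ^ Suc n / (1 - b * q) * (qpoch (a * q) q n / qpoch (b * q * q) q n)"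
proof -
  define A B where "A = qpoch (a * q) q n" and "B = qpoch (b * q) q n"
  have nz: "B \<noteq> 0" "1 - b * q * q ^ n \<noteq> 0"
    using assms by (auto simp: qpoch_Suc B_def)
  have "A * (1 - a * q * q ^ n) / (B * (1 - b * q * q ^ n)) - A / B
      = (b - a) * q ^ Suc n * A / (B * (1 - b * q * q ^ n))"
    using nz by (simp add: divide_simps) (simp add: algebra_simps)
  \<comment> \<open>Both sides are \<open>(bq)_(n+1)\<close>, split at its last and at its first
    factor; this is where \<open>b\<close> becomes \<open>b * q\<close>.\<close>
  also have "B * (1 - b * q * q ^ n) = (1 - b * q) * qpoch (b * q * q) q n"
    unfolding B_def by (metis qpoch_Suc qpoch_Suc_shift)
  finally show ?thesis
    by (simp add: qpoch_Suc A_def B_def flip: qpoch_Suc_shift)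
qed

theorem theorem3p3:
  fixes q a b t :: complex and N :: nat
  assumes "norm q < 1"
    and "N \<ge> 1"
    and "\<And>n. n \<le> N + 1 \<Longrightarrow> qpoch (b * q) q n \<noteq> 0"
    and "qpoch t q (N + 1) \<noteq> 0"
  shows "Fine_F q (N + 1) a b t =
           (1 - t * q ^ (N + 1)) / (1 - t)
           + (1 - q ^ (N + 1)) * (b - a) * t * q / ((1 - b * q) * (1 - t))
             * Fine_F q N a (b * q) (t * q)"
proof -
  note Q_nz = qpoch_self_neq_0[OF assms(1)]
  define r where "r n = qpoch (a * q) q n / qpoch (b * q) q n" for n
  define e where "e n = t ^ n * (qpoch (t * q) q (Suc N - n) / qpoch q q (Suc N - n))" for n
  define K where "K = qpoch q q (Suc N) / qpoch t q (Suc N)"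
  have T: "qpoch t q (Suc N) = (1 - t) * qpoch (t * q) q N"
    by (rule qpoch_Suc_shift)
  have T_nz: "1 - t \<noteq> 0" "qpoch (t * q) q N \<noteq> 0"
    using assms(4) by (auto simp: T)
  have K: "K = (1 - q ^ Suc N) / (1 - t) * (qpoch q q N / qpoch (t * q) q N)"
    unfolding K_def T by (simp add: qpoch_Suc)
  \<comment> \<open>The bound \<open>n \<le> N\<close> makes \<open>Suc N - n\<close> a successor.
    At \<open>n = Suc N\<close> both quotients are 1, so that term is
    \<open>r (Suc N) * e (Suc N)\<close> without a difference.\<close>
  have summand: "qpoch (a * q) q n / qpoch (b * q) q n * t ^ n *
      (qpoch t q (Suc N - n) / qpoch q q (Suc N - n)) = r n * (e n - e (Suc n))"
    if "n \<le> N" for n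
    using that
    by (simp add: r_def e_def Suc_diff_le qpoch_quotient_difference[OF assms(1), of t "N - n"]
        algebra_simps)
  have "Fine_F q (Suc N) a b t
      = K * ((\<Sum>n\<le>N. r n * (e n - e (Suc n))) + r (Suc N) * e (Suc N))"
    unfolding Fine_F_eq[OF assms(1)] K_def sum.atMost_Suc
    using summand by (simp add: r_def e_def)
  also have "\<dots> = K * (r 0 * e 0) + K * (\<Sum>n\<le>N. e (Suc n) * (r (Suc n) - r n))"
    unfolding summation_by_parts by (rule distrib_left)
  \<comment> \<open>Here \<open>r 0 = 1\<close>, \<open>(q)_(N+1)\<close> cancels, and
    \<open>(tq)_(N+1) / (t)_(N+1)\<close> keeps only its extreme factors.\<close>
  also have "K * (r 0 * e 0) = (1 - t * q ^ Suc N) / (1 - t)"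
    using T_nz Q_nz[of "Suc N"]
    by (simp add: K_def r_def e_def T qpoch_Suc[of "t * q"] mult.assoc)
  also have "K * (\<Sum>n\<le>N. e (Suc n) * (r (Suc n) - r n))
      = (1 - q ^ Suc N) * (b - a) * t * q / ((1 - b * q) * (1 - t)) * Fine_F q N a (b * q) (t * q)"
  proof -
    \<comment> \<open>\<open>d n\<close> is the term of \<open>Fine_F q N a (b * q) (t * q)\<close>
      in the form of \<open>Fine_F_eq\<close>. The \<open>q ^ Suc n\<close> from the difference of
      \<open>r\<close> joins the \<open>t ^ Suc n\<close> of \<open>e (Suc n)\<close> to give
      \<open>t * q * (t * q) ^ n\<close>.\<close>
    define d where "d n = qpoch (a * q) q n / qpoch (b * q * q) q n * (t * q) ^ n *
      (qpoch (t * q) q (N - n) / qpoch q q (N - n))" for n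
    have "e (Suc n) * (r (Suc n) - r n) = (b - a) * t * q / (1 - b * q) * d n"
      if "n \<le> N" for n
      using qpoch_ratio_difference[OF assms(3), of n a] that
      by (simp add: r_def e_def d_def power_mult_distrib mult_ac)
    then have "(\<Sum>n\<le>N. e (Suc n) * (r (Suc n) - r n))
        = (b - a) * t * q / (1 - b * q) * (\<Sum>n\<le>N. d n)"
      unfolding sum_distrib_left by (intro sum.cong) auto
    moreover have "Fine_F q N a (b * q) (t * q)
        = qpoch q q N / qpoch (t * q) q N * (\<Sum>n\<le>N. d n)"
      unfolding d_def by (rule Fine_F_eq[OF assms(1)])
    ultimately show ?thesis
      by (simp add: K mult_ac)
  qed
  finally show ?thesis by simp
qed

end
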